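(* Let $n\in\mathbb{N}$, let $\Omega$ be an open subset of $\mathbb{C}$, let $W:\Omega\to(0,+\infty)$ be a continuous function, and let $K$ be a compact subset of $\Omega$. Then there exists a number $C_{n,W,K}>0$ such that for every $f\in\mathcal{A}_n^2(\Omega,W)$ and every $z\in K$, $$|f(z)|\le C_{n,W,K}\,\|f\|_{\mathcal{A}_n^2(\Omega,W)}.$$
   Context: A function $f$ on an open set is $n$-analytic if it is smooth and $(\partial/\partial\overline{z})^n f=0$. $\mathcal{A}_n^2(\Omega,W)$ is the space of $n$-analytic functions on $\Omega$ belonging to $L^2(\Omega,W)$ (the $L^2$ space for the measure $W\,\mathrm{d}\mu$, with $\mu$ Lebesgue plane measure), provided with the norm of $L^2(\Omega,W)$. *)

theory Defs
  imports "HOL-Analysis.Analysis"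
begin

(* All functions on an open set Omega are total functions on the complex plane; every notion
   below depends only on their values on Omega. *)

(* C^k in the real sense: k-fold Frechet differentiability over the reals, with continuous
   iterated directional derivatives. *)
fun Ck_on :: "nat \<Rightarrow> (complex \<Rightarrow> complex) \<Rightarrow> complex set \<Rightarrow> bool" where
  "Ck_on 0 f \<Omega> \<longleftrightarrow> continuous_on \<Omega> f"
| "Ck_on (Suc k) f \<Omega> \<longleftrightarrow>
     (\<forall>z\<in>\<Omega>. f differentiable (at z)) \<and> (\<forall>v. Ck_on k (\<lambda>z. frechet_derivative f (at z) v) \<Omega>)"

definition smooth_on :: "(complex \<Rightarrow> complex) \<Rightarrow> complex set \<Rightarrow> bool" where
  "smooth_on f \<Omega> \<longleftrightarrow> (\<forall>k. Ck_on k f \<Omega>)"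

(* The Wirtinger derivative (d/dx + i d/dy) / 2 with respect to the conjugate variable;
   the partial derivatives are the real derivatives in the directions 1 and i. *)
definition dbar :: "(complex \<Rightarrow> complex) \<Rightarrow> complex \<Rightarrow> complex" where
  "dbar f z = (frechet_derivative f (at z) 1 + \<i> * frechet_derivative f (at z) \<i>) / 2"

definition n_analytic_on :: "nat \<Rightarrow> (complex \<Rightarrow> complex) \<Rightarrow> complex set \<Rightarrow> bool" where
  "n_analytic_on n f \<Omega> \<longleftrightarrow> smooth_on f \<Omega> \<and> (\<forall>z\<in>\<Omega>. (dbar ^^ n) f z = 0)"

definition weighted_measure :: "complex set \<Rightarrow> (complex \<Rightarrow> real) \<Rightarrow> complex measure" where
  "weighted_measure \<Omega> W = density (lebesgue_on \<Omega>) (\<lambda>z. ennreal (W z))"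

(* Members of L2 are represented by functions rather than by classes modulo null sets; an
   n-analytic function is continuous, hence determined on Omega by its class. *)
definition L2 :: "complex set \<Rightarrow> (complex \<Rightarrow> real) \<Rightarrow> (complex \<Rightarrow> complex) set" where
  "L2 \<Omega> W = {f. f \<in> borel_measurable (weighted_measure \<Omega> W) \<and>
                integrable (weighted_measure \<Omega> W) (\<lambda>z. (norm (f z))\<^sup>2)}"

definition L2_norm :: "complex set \<Rightarrow> (complex \<Rightarrow> real) \<Rightarrow> (complex \<Rightarrow> complex) \<Rightarrow> real" where
  "L2_norm \<Omega> W f = sqrt (\<integral>z. (norm (f z))\<^sup>2 \<partial>(weighted_measure \<Omega> W))"

definition poly_bergman :: "nat \<Rightarrow> complex set \<Rightarrow> (complex \<Rightarrow> real) \<Rightarrow> (complex \<Rightarrow> complex) set" where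
  "poly_bergman n \<Omega> W = {f \<in> L2 \<Omega> W. n_analytic_on n f \<Omega>}"

end

(* An n-analytic f has the form f(z) = sum_{k<n} conj(z - a)^k h_k(z) with holomorphic h_k (subtract
   an explicit dbar-primitive of dbar f, by induction on n). Rotation invariance of Lebesgue measure
   makes the monomials conj(u)^k u^m with k, m distinct have mean zero over the unit disc, so the disc
   mean M(r) = int_{|u| <= 1} f(a + r u) du is a polynomial of degree < n in r^2. Hence the n-th
   finite difference of j |-> M(sqrt j s) vanishes, which expresses f(a), up to the area of the
   disc, through the means M(sqrt j s) with 1 <= j <= n. Those are controlled by the L^2 norm of f,
   uniformly in a, as W is bounded below near K. *)

theory Submission
  imports Defs "HOL-Complex_Analysis.Cauchy_Integral_Formula"
begin

section \<open>Rotation invariance of plane Lebesgue measure\<close>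

text \<open>Both measures give a box the product of its side lengths, and this determines
  \<open>lborel\<close>. The identification makes the determinant formula for linear images in
  \<open>real^2\<close> applicable to maps of the complex plane.\<close>

lemma lborel_distr_vec_complex:
  "distr lborel borel (\<lambda>v :: real^2. Complex (v $ 1) (v $ 2)) = lborel"
proof (rule lborel_eqI[symmetric])
  have meas: "(\<lambda>v :: real^2. Complex (v $ 1) (v $ 2)) \<in> borel_measurable borel"
    by (intro borel_measurable_continuous_onI continuous_intros)
  fix l u :: complex
  assume le: "\<And>b. b \<in> Basis \<Longrightarrow> l \<bullet> b \<le> u \<bullet> b"
  have "(\<lambda>v :: real^2. Complex (v $ 1) (v $ 2)) -` box l u = box (vector [Re l, Im l]) (vector [Re u, Im u])"
    by (auto simp: in_box_complex_iff mem_box_cart forall_2)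
  moreover have "emeasure lborel (box (vector [Re l, Im l]) (vector [Re u, Im u] :: real^2)) =
      (\<Prod>b\<in>Basis. (u - l) \<bullet> b)"
    using le[of 1] le[of \<i>] by (subst emeasure_lborel_box)
      (auto simp: Basis_complex_def Basis_vec_def inner_axis axis_eq_axis UNIV_2 image_iff mult.commute)
  ultimately show "emeasure (distr lborel borel (\<lambda>v :: real^2. Complex (v $ 1) (v $ 2))) (box l u) =
      (\<Prod>b\<in>Basis. (u - l) \<bullet> b)"
    using meas by (simp add: emeasure_distr)
qed simp

text \<open>In real coordinates, the preimage of a box under multiplication by
  \<open>\<omega>\<close> is the image of the box under the inverse rotation, whose matrix has
  determinant of modulus 1. Agreement on boxes suffices.\<close>

lemma lborel_distr_rotation:
  assumes "norm \<omega> = 1"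
  shows "distr lborel borel ((*) \<omega>) = (lborel :: complex measure)"
proof (rule lborel_eqI[symmetric])
  define V where "V = (\<lambda>v :: real^2. Complex (v $ 1) (v $ 2))"
  \<comment> \<open>\<open>g\<close> is multiplication by \<open>cnj \<omega>\<close>, the inverse
    of multiplication by \<open>\<omega>\<close>, in real coordinates.\<close>
  define g where "g = (\<lambda>v :: real^2. vector [Re \<omega> * v $ 1 + Im \<omega> * v $ 2, Re \<omega> * v $ 2 - Im \<omega> * v $ 1] :: real^2)"
  have Vm [measurable]: "V \<in> borel_measurable borel" unfolding V_def
    by (intro borel_measurable_continuous_onI continuous_intros)
  have V: "emeasure lborel (V -` S) = emeasure lborel S" if "S \<in> sets borel" for S
    using emeasure_distr[of V lborel borel S] that Vm lborel_distr_vec_complex by (simp add: V_def[symmetric])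
  have w1: "Re \<omega> * Re \<omega> + Im \<omega> * Im \<omega> = 1"
    using assms by (simp add: cmod_def power2_eq_square)
  have w2: "Re \<omega> * (Re \<omega> * x) + Im \<omega> * (Im \<omega> * x) = x"
    "Im \<omega> * (Im \<omega> * x) + Re \<omega> * (Re \<omega> * x) = x" for x
    using arg_cong[OF w1, of "\<lambda>t. t * x"] by (simp_all add: algebra_simps)
  have lin: "linear g"
    by (rule linearI) (simp_all add: g_def vec_eq_iff forall_2 algebra_simps)
  have det: "\<bar>det (matrix g)\<bar> = 1"
    using w1 by (simp add: det_2 matrix_def g_def axis_def)
  have Vg: "\<omega> * V (g v) = V v" for v
    by (simp add: V_def g_def complex_eq_iff algebra_simps w2)
  \<comment> \<open>The witness has the coordinates of \<open>\<omega>\<close> times the point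
    represented by \<open>v\<close>.\<close>
  have gV: "\<exists>w. v = g w" for v
    by (rule exI[of _ "vector [Re \<omega> * v $ 1 - Im \<omega> * v $ 2, Re \<omega> * v $ 2 + Im \<omega> * v $ 1]"])
      (simp add: g_def vec_eq_iff forall_2 algebra_simps w2)
  fix l u :: complex
  assume le: "\<And>b. b \<in> Basis \<Longrightarrow> l \<bullet> b \<le> u \<bullet> b"
  \<comment> \<open>Turns a preimage into a linear image, the form that
    \<open>measure_linear_image\<close> handles.\<close>
  have eq: "V -` ((*) \<omega> -` box l u) = g ` (V -` box l u)"
    using gV by (force simp: Vg)
  have [measurable]: "V -` box l u \<in> sets borel"
    using measurable_sets[of V borel borel "box l u"] by simp
  have [measurable]: "(*) \<omega> -` box l u \<in> sets borel"
    using measurable_sets[of "(*) \<omega>" borel borel "box l u"] by simp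
  have fin: "emeasure lborel (V -` box l u) < \<infinity>"
    by (subst V) (auto simp: emeasure_lborel_box_eq)
  then have m: "V -` box l u \<in> lmeasurable"
    by (auto simp: fmeasurable_def)
  have "emeasure lborel ((*) \<omega> -` box l u) = emeasure lebesgue (g ` (V -` box l u))"
    using measurable_sets_borel[OF Vm \<open>(*) \<omega> -` box l u \<in> sets borel\<close>]
    by (subst V[symmetric]) (simp_all add: eq[symmetric])
  also have "\<dots> = measure lebesgue (V -` box l u)"
    using measure_linear_image[OF lin m] measurable_linear_image[OF lin m] det
    by (simp add: emeasure_eq_measure2)
  also have "\<dots> = emeasure lborel (box l u)"
    using m by (subst emeasure_eq_measure2[symmetric]) (auto simp: V)
  finally show "emeasure (distr lborel borel ((*) \<omega>)) (box l u) = (\<Prod>b\<in>Basis. (u - l) \<bullet> b)"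
    using le by (simp add: emeasure_distr emeasure_lborel_box)
qed simp

section \<open>Finite differences of powers\<close>

text \<open>The n-th finite difference kills polynomials of degree below n. Absorbing a factor j
  into the binomial coefficient lowers both n and the exponent by one; after the index shift,
  expanding the power of j + 1 leaves sums with smaller exponents. As all of these occur, the
  induction is a strong one.\<close>

lemma sum_choose_alternating_power:
  "k < n \<Longrightarrow> (\<Sum>j\<le>n. (-1) ^ j * of_nat (n choose j) * of_nat j ^ k) = (0 :: 'a :: comm_ring_1)"
proof (induction k arbitrary: n rule: less_induct)
  case (less k)
  show ?case
  proof (cases k)
    case 0
    then show ?thesis
      using less.prems choose_alternating_sum[of n, where 'a='a] by simp
  next
    case (Suc l)
    then obtain m where n: "n = Suc m" and lm: "l < m"
      using less.prems by (cases n) auto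
    have absorb: "of_nat (Suc m choose Suc j) * of_nat (Suc j) = (of_nat (Suc m) * of_nat (m choose j) :: 'a)" for j
      by (metis Suc_times_binomial_eq mult.commute of_nat_mult)
    have "(\<Sum>j\<le>n. (-1) ^ j * of_nat (n choose j) * of_nat j ^ k)
        = (\<Sum>j\<le>m. (-1) ^ Suc j * (of_nat (Suc m choose Suc j) * of_nat (Suc j)) * of_nat (Suc j) ^ l :: 'a)"
      unfolding n Suc by (subst sum.atMost_Suc_shift) (simp add: mult_ac)
    also have "\<dots> = - of_nat (Suc m) * (\<Sum>j\<le>m. (-1) ^ j * of_nat (m choose j) * (of_nat j + 1) ^ l)"
      unfolding absorb sum_distrib_left by (intro sum.cong) (simp_all add: algebra_simps)
    also have "(\<Sum>j\<le>m. (-1) ^ j * of_nat (m choose j) * (of_nat j + 1) ^ l)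
        = (\<Sum>i\<le>l. of_nat (l choose i) * (\<Sum>j\<le>m. (-1) ^ j * of_nat (m choose j) * of_nat j ^ i) :: 'a)"
      unfolding binomial_ring by (simp add: sum_distrib_left mult_ac) (rule sum.swap)
    also have "\<dots> = 0"
      using less.IH lm Suc by (intro sum.neutral) auto
    finally show ?thesis by simp
  qed
qed

section \<open>Integrals over the closed unit disc\<close>

text \<open>The measure is not normalised: the integral of a constant carries the area of the disc
  as a factor.\<close>

definition disc :: "complex measure" where
  "disc = restrict_space lborel (cball 0 1)"

lemma space_disc [simp]: "space disc = cball 0 1"
  by (simp add: disc_def space_restrict_space)

lemma finite_measure_disc: "finite_measure disc"
  by (rule finite_measureI) (simp add: disc_def emeasure_restrict_space space_restrict_space emeasure_cball)

lemma measure_disc_pos: "measure disc (cball 0 1) > 0"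
  by (simp add: disc_def measure_restrict_space content_cball_pos)

lemma integrable_disc_continuous:
  fixes f :: "complex \<Rightarrow> 'a :: {banach, second_countable_topology}"
  assumes "continuous_on (cball 0 1) f"
  shows "integrable disc f"
proof -
  obtain B where B: "\<And>u. u \<in> cball 0 1 \<Longrightarrow> norm (f u) \<le> B"
    using compact_imp_bounded[OF compact_continuous_image[OF assms compact_cball]]
    unfolding bounded_iff by blast
  have "f \<in> borel_measurable (restrict_space borel (cball 0 1))"
    using assms by (rule borel_measurable_continuous_on_restrict)
  then have "f \<in> borel_measurable disc"
    by (simp add: disc_def cong: measurable_cong_sets sets_restrict_space_cong)
  then show ?thesis
    using B by (intro finite_measure.integrable_const_bound[OF finite_measure_disc, of _ B] AE_I2) auto
qed

text \<open>A suitable rotation preserves the disc and the measure but changes the sign of the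
  integrand, so the integral equals its own negative.\<close>

lemma integral_disc_monomial:
  assumes "k \<noteq> m"
  shows "(\<integral>u. cnj u ^ k * u ^ m \<partial>disc) = 0"
proof -
  define F where "F = (\<lambda>u. indicator (cball 0 1) u *\<^sub>R (cnj u ^ k * u ^ m))"
  \<comment> \<open>Rotation by \<open>\<theta>\<close> multiplies the monomial by
    \<open>cis ((m - k) * \<theta>)\<close>; this angle makes the factor \<open>cis pi\<close>, that
    is -1.\<close>
  define \<theta> where "\<theta> = pi / (real m - real k)"
  have [measurable]: "F \<in> borel_measurable borel"
    unfolding F_def
    by (intro borel_measurable_scaleR borel_measurable_indicator borel_measurable_continuous_onI continuous_intros) auto
  have "cnj (cis \<theta>) ^ k * cis \<theta> ^ m = cis ((real m - real k) * \<theta>)"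
    by (simp add: cis_cnj Complex.DeMoivre cis_mult left_diff_distrib)
  also have "\<dots> = -1"
    using assms by (simp add: \<theta>_def)
  finally have "F (cis \<theta> * u) = - F u" for u
    using arg_cong[of "cnj (cis \<theta>) ^ k * cis \<theta> ^ m" "-1" "\<lambda>c. c * (cnj u ^ k * u ^ m)"]
    by (simp add: F_def indicator_def norm_mult power_mult_distrib mult_ac)
  moreover have "integral\<^sup>L lborel F = (\<integral>u. F (cis \<theta> * u) \<partial>lborel)"
    by (subst lborel_distr_rotation[of "cis \<theta>", symmetric]) (auto intro: integral_distr)
  ultimately have "integral\<^sup>L lborel F = 0" by simp
  then show ?thesis
    by (simp add: F_def disc_def integral_restrict_space)
qed

text \<open>Expand \<open>h\<close> in its Taylor series at \<open>a\<close> and integrate term by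
  term: by orthogonality of the monomials only the term of degree \<open>k\<close> survives.\<close>

lemma integral_disc_holomorphic:
  assumes hol: "h holomorphic_on ball a R" and r: "0 \<le> r" "r < R"
  shows "(\<integral>u. cnj u ^ k * h (a + of_real r * u) \<partial>disc) =
    (deriv ^^ k) h a / fact k * of_real r ^ k * (\<integral>u. cnj u ^ k * u ^ k \<partial>disc)"
proof -
  interpret finite_measure disc by (rule finite_measure_disc)
  define c where "c m = (deriv ^^ m) h a / fact m" for m
  define F where "F m u = cnj u ^ k * (c m * (of_real r * u) ^ m)" for m u
  define v where "v = measure disc (cball 0 1)"
  have sums: "(\<lambda>m. c m * (w - a) ^ m) sums h w" if "w \<in> ball a R" for w
    unfolding c_def by (rule holomorphic_power_series[OF hol that])
  have summ: "summable (\<lambda>m. norm (c m * of_real r ^ m))"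
  proof -
    \<comment> \<open>Convergence at a radius strictly between \<open>r\<close> and \<open>R\<close>
      gives absolute convergence at \<open>r\<close>.\<close>
    obtain \<rho> where \<rho>: "r < \<rho>" "\<rho> < R"
      using r dense by blast
    have "a + of_real \<rho> \<in> ball a R"
      using r \<rho> by (simp add: dist_norm)
    from sums_summable[OF sums[OF this]] have "summable (\<lambda>m. c m * of_real \<rho> ^ m)"
      by simp
    moreover have "norm (of_real r :: complex) < norm (of_real \<rho> :: complex)"
      using r \<rho> by simp
    ultimately show ?thesis
      by (rule powser_insidea)
  qed
  \<comment> \<open>A majorant independent of \<open>u\<close>, which justifies exchanging sum and
    integral.\<close>
  have bound: "norm (F m u) \<le> norm (c m * of_real r ^ m)" if "u \<in> cball 0 1" for m u
  proof -
    have "norm u ^ k * norm u ^ m \<le> 1"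
      using that by (simp add: power_le_one mult_le_one)
    from mult_left_mono[OF this, of "norm (c m) * r ^ m"] show ?thesis
      using r by (simp add: F_def norm_mult norm_power power_mult_distrib mult_ac)
  qed
  have intF: "integrable disc (F m)" for m
    unfolding F_def by (intro integrable_disc_continuous continuous_intros)
  have "(\<lambda>m. integral\<^sup>L disc (F m)) sums (\<integral>u. (\<Sum>m. F m u) \<partial>disc)"
  proof (rule sums_integral[OF intF])
    show "AE u in disc. summable (\<lambda>m. norm (F m u))"
      by (rule AE_I2, rule summable_comparison_test[OF _ summ]) (use bound in auto)
    have "(\<integral>u. norm (F m u) \<partial>disc) \<le> v * norm (c m * of_real r ^ m)" for m
    proof -
      have "(\<integral>u. norm (F m u) \<partial>disc) \<le> (\<integral>u. norm (c m * of_real r ^ m) \<partial>disc)"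
        using bound by (intro integral_mono integrable_norm intF) auto
      then show ?thesis by (simp add: v_def)
    qed
    then show "summable (\<lambda>m. \<integral>u. norm (F m u) \<partial>disc)"
      by (intro summable_comparison_test[OF _ summable_mult[OF summ, of v]]) (auto simp: integral_nonneg_AE)
  qed
  also have "(\<integral>u. (\<Sum>m. F m u) \<partial>disc) = (\<integral>u. cnj u ^ k * h (a + of_real r * u) \<partial>disc)"
  proof (rule Bochner_Integration.integral_cong[OF refl])
    fix u assume "u \<in> space disc"
    then have "r * norm u \<le> r * 1"
      using r by (intro mult_left_mono) auto
    then have "a + of_real r * u \<in> ball a R"
      using r by (simp add: dist_norm norm_mult)
    from sums_mult[OF sums[OF this], of "cnj u ^ k"]
    show "(\<Sum>m. F m u) = cnj u ^ k * h (a + of_real r * u)"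
      by (simp add: F_def sums_iff)
  qed
  finally have 1: "(\<lambda>m. integral\<^sup>L disc (F m)) sums (\<integral>u. cnj u ^ k * h (a + of_real r * u) \<partial>disc)" .
  have F: "integral\<^sup>L disc (F m) = c m * of_real r ^ m * (\<integral>u. cnj u ^ k * u ^ m \<partial>disc)" for m
  proof -
    have "F m = (\<lambda>u. c m * of_real r ^ m * (cnj u ^ k * u ^ m))"
      by (auto simp: F_def power_mult_distrib mult_ac)
    then show ?thesis by (simp only: integral_mult_right_zero)
  qed
  have "integral\<^sup>L disc (F m) = 0" if "m \<noteq> k" for m
    using integral_disc_monomial[of k m] that by (simp add: F)
  then have "(\<lambda>m. if m = k then integral\<^sup>L disc (F m) else 0) = (\<lambda>m. integral\<^sup>L disc (F m))"
    by auto
  with sums_single[of k "\<lambda>m. integral\<^sup>L disc (F m)"]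
  have 2: "(\<lambda>m. integral\<^sup>L disc (F m)) sums integral\<^sup>L disc (F k)"
    by (simp only:)
  show ?thesis
    using sums_unique2[OF 1 2] by (simp add: F c_def)
qed

section \<open>Smooth functions and the structure of n-analytic functions\<close>

lemma has_derivative_cong_open:
  assumes "open \<Omega>" "z \<in> \<Omega>" "\<And>w. w \<in> \<Omega> \<Longrightarrow> f w = g w"
  shows "(f has_derivative D) (at z) \<longleftrightarrow> (g has_derivative D) (at z)"
  using has_derivative_transform_within_open[of f D z UNIV \<Omega> g]
    has_derivative_transform_within_open[of g D z UNIV \<Omega> f] assms by auto

text \<open>Derivatives at points of an open set depend only on the values there. Formulas for
  \<open>frechet_derivative\<close> are available only at points of \<open>\<Omega>\<close>, so they
  can be substituted inside \<open>Ck_on\<close> only through such a congruence.\<close>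

lemma Ck_on_cong:
  assumes "open \<Omega>"
  shows "(\<And>z. z \<in> \<Omega> \<Longrightarrow> f z = g z) \<Longrightarrow> Ck_on k f \<Omega> \<longleftrightarrow> Ck_on k g \<Omega>"
proof (induction k arbitrary: f g)
  case 0
  then show ?case by (simp cong: continuous_on_cong)
next
  case (Suc k)
  have der: "(f has_derivative D) (at z) \<longleftrightarrow> (g has_derivative D) (at z)" if "z \<in> \<Omega>" for z D
    using that Suc.prems by (rule has_derivative_cong_open[OF assms])
  then have eq: "frechet_derivative f (at z) = frechet_derivative g (at z)" if "z \<in> \<Omega>" for z
    using that by (simp add: frechet_derivative_def)
  have "f differentiable at z \<longleftrightarrow> g differentiable at z" if "z \<in> \<Omega>" for z
    using that der by (simp add: differentiable_def)
  moreover have "Ck_on k (\<lambda>z. frechet_derivative f (at z) v) \<Omega> \<longleftrightarrow>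
      Ck_on k (\<lambda>z. frechet_derivative g (at z) v) \<Omega>" for v
    by (rule Suc.IH) (simp add: eq)
  ultimately show ?case by simp
qed

text \<open>Serves the smoothness of \<open>dbar f\<close>, a combination of two directional
  derivatives with coefficients 1/2 and \<open>\<i>/2\<close>.\<close>

lemma Ck_on_linear_combination:
  assumes "open \<Omega>"
  shows "Ck_on k f \<Omega> \<Longrightarrow> Ck_on k g \<Omega> \<Longrightarrow> Ck_on k (\<lambda>z. c * f z + d * g z) \<Omega>"
proof (induction k arbitrary: f g)
  case 0
  then show ?case by (auto intro!: continuous_intros)
next
  case (Suc k)
  have der: "((\<lambda>z. c * f z + d * g z) has_derivative
      (\<lambda>v. c * frechet_derivative f (at z) v + d * frechet_derivative g (at z) v)) (at z)"
    if "z \<in> \<Omega>" for z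
    using Suc.prems that
    by (auto intro!: derivative_intros simp: frechet_derivative_works[symmetric])
  then have "frechet_derivative (\<lambda>z. c * f z + d * g z) (at z) =
      (\<lambda>v. c * frechet_derivative f (at z) v + d * frechet_derivative g (at z) v)"
    if "z \<in> \<Omega>" for z
    using frechet_derivative_at[OF der[OF that]] by simp
  then have "Ck_on k (\<lambda>z. frechet_derivative (\<lambda>z. c * f z + d * g z) (at z) v) \<Omega> \<longleftrightarrow>
      Ck_on k (\<lambda>z. c * frechet_derivative f (at z) v + d * frechet_derivative g (at z) v) \<Omega>" for v
    by (intro Ck_on_cong[OF assms]) simp
  then show ?case
    unfolding Ck_on.simps differentiable_def
    using Suc.IH Suc.prems der unfolding Ck_on.simps by blast
qed

lemma smooth_on_dbar:
  assumes "open \<Omega>" "smooth_on f \<Omega>"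
  shows "smooth_on (dbar f) \<Omega>"
  unfolding smooth_on_def
proof
  fix k
  have "Ck_on (Suc k) f \<Omega>"
    using assms by (simp only: smooth_on_def)
  then have "Ck_on k (\<lambda>z. 1/2 * frechet_derivative f (at z) 1 + \<i>/2 * frechet_derivative f (at z) \<i>) \<Omega>"
    by (intro Ck_on_linear_combination[OF assms(1)]) auto
  then show "Ck_on k (dbar f) \<Omega>"
    by (simp add: dbar_def[abs_def] add_divide_distrib)
qed

text \<open>The induction hypothesis expands \<open>dbar f\<close>. Raising each power of
  \<open>cnj (z - a)\<close> by one and dividing by the new exponent gives a primitive for
  \<open>dbar\<close>; what remains of \<open>f\<close> satisfies the Cauchy-Riemann equation and
  becomes the coefficient of degree 0.\<close>

lemma n_analytic_decomposition:
  assumes "open \<Omega>"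
  shows "n_analytic_on n f \<Omega> \<Longrightarrow>
    \<exists>h. (\<forall>k. h k holomorphic_on \<Omega>) \<and> (\<forall>z\<in>\<Omega>. f z = (\<Sum>k<n. cnj (z - a) ^ k * h k z))"
proof (induction n arbitrary: f)
  case 0
  then show ?case
    by (auto simp: n_analytic_on_def intro!: exI[of _ "\<lambda>_ _. 0"])
next
  case (Suc n)
  have sm: "smooth_on f \<Omega>"
    using Suc.prems by (simp add: n_analytic_on_def)
  \<comment> \<open>\<open>funpow_Suc_right\<close> peels off the innermost \<open>dbar\<close>, the
    one applied to \<open>f\<close> first.\<close>
  have "n_analytic_on n (dbar f) \<Omega>"
    using Suc.prems smooth_on_dbar[OF assms sm]
    by (simp add: n_analytic_on_def funpow_Suc_right del: funpow.simps)
  then obtain h where hol: "\<And>k. h k holomorphic_on \<Omega>"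
    and h: "\<And>z. z \<in> \<Omega> \<Longrightarrow> dbar f z = (\<Sum>k<n. cnj (z - a) ^ k * h k z)"
    using Suc.IH by blast
  define H where "H z = f z - (\<Sum>k<n. cnj (z - a) ^ Suc k * (h k z / of_nat (Suc k)))" for z
  have "H field_differentiable at z" if z: "z \<in> \<Omega>" for z
  proof -
    have "f differentiable at z"
      using sm z unfolding smooth_on_def by (auto dest: spec[of _ "Suc 0"])
    then have f': "(f has_derivative frechet_derivative f (at z)) (at z)"
      by (simp add: frechet_derivative_works)
    have h': "(h k has_derivative (\<lambda>v. deriv (h k) z * v)) (at z)" for k
      using holomorphic_derivI[OF hol assms z, of k] by (simp add: has_field_derivative_def)
    \<comment> \<open>Product rule: the first summand is complex linear in \<open>v\<close>, the
      second antilinear.\<close>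
    define T where "T k v = cnj (z - a) ^ Suc k * (deriv (h k) z * v / of_nat (Suc k))
        + cnj v * cnj (z - a) ^ k * h k z" for k v
    have T: "((\<lambda>z. cnj (z - a) ^ Suc k * (h k z / of_nat (Suc k))) has_derivative T k) (at z)" for k
    proof -
      have "((\<lambda>z. cnj (z - a) ^ Suc k) has_derivative
          (\<lambda>v. of_nat (Suc k) * (cnj v * cnj (z - a) ^ k))) (at z)"
        by (rule derivative_eq_intros has_derivative_cnj refl)+ (simp add: mult_ac)
      from has_derivative_mult[OF this bounded_linear.has_derivative[OF bounded_linear_divide h']]
      show ?thesis
        by (rule has_derivative_eq_rhs) (simp add: T_def fun_eq_iff del: of_nat_Suc)
    qed
    define D where "D v = frechet_derivative f (at z) v - (\<Sum>k<n. T k v)" for v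
    have D: "(H has_derivative D) (at z)"
      unfolding H_def D_def by (intro has_derivative_diff f' has_derivative_sum T)
    have "D 1 + \<i> * D \<i> = 2 * dbar f z - (\<Sum>k<n. T k 1 + \<i> * T k \<i>)"
      by (simp add: D_def dbar_def sum.distrib sum_distrib_left algebra_simps)
    \<comment> \<open>In \<open>T k 1 + \<i> * T k \<i>\<close> the complex linear part cancels and
      the antilinear part doubles.\<close>
    also have "(\<Sum>k<n. T k 1 + \<i> * T k \<i>) = 2 * dbar f z"
      unfolding h[OF z] sum_distrib_left by (intro sum.cong) (simp_all add: T_def algebra_simps)
    \<comment> \<open>The Cauchy-Riemann equation; it makes the real linear map \<open>D\<close>
      complex linear.\<close>
    finally have "D \<i> = \<i> * D 1"
      by (simp add: complex_eq_iff)
    interpret D: linear D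
      using D by (rule has_derivative_linear)
    have "D v = D 1 * v" for v
    proof -
      have "D v = D (Re v *\<^sub>R 1 + Im v *\<^sub>R \<i>)"
        by (rule arg_cong[of _ _ D]) (simp add: complex_eq_iff)
      also have "\<dots> = D 1 * v"
        unfolding D.add D.scaleR \<open>D \<i> = \<i> * D 1\<close> by (simp add: complex_eq_iff)
      finally show ?thesis .
    qed
    then have "D = (*) (D 1)" by blast
    with D show ?thesis
      unfolding field_differentiable_def has_field_derivative_def by metis
  qed
  then have H: "H holomorphic_on \<Omega>"
    by (simp add: holomorphic_on_def field_differentiable_at_within)
  \<comment> \<open>The remainder \<open>H\<close> takes index 0 and the old coefficients move up by
    one, each divided by its new exponent.\<close>
  define g where "g k = (case k of 0 \<Rightarrow> H | Suc k \<Rightarrow> \<lambda>z. h k z / of_nat (Suc k))" for k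
  have "g k holomorphic_on \<Omega>" for k
    using H hol by (auto simp: g_def split: nat.split intro!: holomorphic_intros)
  moreover have "f z = (\<Sum>k<Suc n. cnj (z - a) ^ k * g k z)" for z
    by (subst sum.lessThan_Suc_shift) (simp add: g_def H_def)
  ultimately show ?case by blast
qed

section \<open>Disc means of n-analytic functions\<close>

text \<open>The disc mean is a polynomial of degree below \<open>n\<close> in the squared radius.
  The radii \<open>sqrt j * s\<close> have equally spaced squares, so the alternating sum is an n-th
  finite difference of that polynomial.\<close>

lemma disc_mean_alternating_sum:
  assumes hol: "\<And>k. h k holomorphic_on ball a R"
    and f: "\<And>z. z \<in> ball a R \<Longrightarrow> f z = (\<Sum>k<n. cnj (z - a) ^ k * h k z)"
    and s: "0 \<le> s" "sqrt (real n) * s < R"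
  shows "(\<Sum>j\<le>n. (-1) ^ j * of_nat (n choose j) *
    (\<integral>u. f (a + of_real (sqrt (real j) * s) * u) \<partial>disc)) = 0"
proof -
  \<comment> \<open>The coefficients of the mean in powers of the squared radius: one factor
    \<open>r ^ k\<close> comes from \<open>cnj (z - a) ^ k\<close>, another from the Taylor term of
    \<open>h k\<close>.\<close>
  define b where "b k = (deriv ^^ k) (h k) a / fact k * (\<integral>u. cnj u ^ k * u ^ k \<partial>disc)" for k
  have mean: "(\<integral>u. f (a + of_real r * u) \<partial>disc) = (\<Sum>k<n. of_real (r\<^sup>2) ^ k * b k)"
    if r: "0 \<le> r" "r < R" for r
  proof -
    have ball: "a + of_real r * u \<in> ball a R" if "u \<in> cball 0 1" for u
    proof -
      have "r * norm u \<le> r * 1"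
        using that r by (intro mult_left_mono) auto
      then show ?thesis
        using r by (simp add: dist_norm norm_mult)
    qed
    have "(\<integral>u. f (a + of_real r * u) \<partial>disc) =
        (\<integral>u. (\<Sum>k<n. of_real r ^ k * (cnj u ^ k * h k (a + of_real r * u))) \<partial>disc)"
    proof (rule Bochner_Integration.integral_cong[OF refl])
      fix u assume "u \<in> space disc"
      then have "a + of_real r * u \<in> ball a R"
        using ball by simp
      from f[OF this] show "f (a + of_real r * u) =
          (\<Sum>k<n. of_real r ^ k * (cnj u ^ k * h k (a + of_real r * u)))"
        by (simp add: power_mult_distrib mult_ac)
    qed
    also have "\<dots> = (\<Sum>k<n. of_real r ^ k * (\<integral>u. cnj u ^ k * h k (a + of_real r * u) \<partial>disc))"
    proof (subst Bochner_Integration.integral_sum)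
      show "integrable disc (\<lambda>u. of_real r ^ k * (cnj u ^ k * h k (a + of_real r * u)))" for k
      proof (intro integrable_disc_continuous continuous_intros)
        show "continuous_on (cball 0 1) (\<lambda>u. h k (a + of_real r * u))"
          using ball
          by (intro continuous_on_compose2[OF holomorphic_on_imp_continuous_on[OF hol]] continuous_intros) auto
      qed
    qed simp
    also have "\<dots> = (\<Sum>k<n. of_real (r\<^sup>2) ^ k * b k)"
      unfolding integral_disc_holomorphic[OF hol r] b_def
      by (simp add: power2_eq_square power_mult_distrib ac_simps)
    finally show ?thesis .
  qed
  have "(\<integral>u. f (a + of_real (sqrt (real j) * s) * u) \<partial>disc) =
      (\<Sum>k<n. of_nat j ^ k * (of_real (s\<^sup>2) ^ k * b k))" if "j \<le> n" for j
  proof -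
    have "sqrt (real j) * s \<le> sqrt (real n) * s"
      using that s by (intro mult_right_mono) auto
    then have "(\<integral>u. f (a + of_real (sqrt (real j) * s) * u) \<partial>disc) =
        (\<Sum>k<n. of_real ((sqrt (real j) * s)\<^sup>2) ^ k * b k)"
      using s by (intro mean) auto
    also have "(sqrt (real j) * s)\<^sup>2 = real j * s\<^sup>2"
      by (simp add: power_mult_distrib)
    finally show ?thesis
      by (simp add: power_mult_distrib mult_ac)
  qed
  then have "(\<Sum>j\<le>n. (-1) ^ j * of_nat (n choose j) *
      (\<integral>u. f (a + of_real (sqrt (real j) * s) * u) \<partial>disc)) =
      (\<Sum>j\<le>n. \<Sum>k<n. of_real (s\<^sup>2) ^ k * b k * ((-1) ^ j * of_nat (n choose j) * of_nat j ^ k))"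
    by (intro sum.cong refl) (simp only: atMost_iff sum_distrib_left mult_ac)
  also have "\<dots> = (\<Sum>k<n. of_real (s\<^sup>2) ^ k * b k * (\<Sum>j\<le>n. (-1) ^ j * of_nat (n choose j) * of_nat j ^ k))"
    by (subst sum.swap) (simp only: sum_distrib_left)
  also have "\<dots> = 0"
    by (intro sum.neutral) (simp add: sum_choose_alternating_power)
  finally show ?thesis .
qed

section \<open>Disc means and the weighted norm\<close>

text \<open>Change of variables \<open>z = a + r * u\<close>, with Jacobian
  \<open>r\<^sup>2\<close>. Measurability is asked only after cutting off to the ball, because the
  functions of interest are controlled only on \<open>\<Omega>\<close>.\<close>

lemma nn_integral_disc_affine:
  assumes meas: "(\<lambda>z. g z * indicator (cball a r) z) \<in> borel_measurable borel" and r: "0 < r"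
  shows "(\<integral>\<^sup>+z. g z * indicator (cball a r) z \<partial>lborel) =
    ennreal (r\<^sup>2) * (\<integral>\<^sup>+u. g (a + of_real r * u) \<partial>disc)"
proof -
  have "lborel = density (distr lborel borel (\<lambda>u. a + r *\<^sub>R u)) (\<lambda>_. ennreal (r\<^sup>2))"
    using lborel_affine[of r a] r by simp
  then have "(\<integral>\<^sup>+z. g z * indicator (cball a r) z \<partial>lborel) =
      (\<integral>\<^sup>+z. g z * indicator (cball a r) z
        \<partial>density (distr lborel borel (\<lambda>u. a + r *\<^sub>R u)) (\<lambda>_. ennreal (r\<^sup>2)))"
    by simp
  also have "\<dots> = ennreal (r\<^sup>2) *
      (\<integral>\<^sup>+u. g (a + r *\<^sub>R u) * indicator (cball a r) (a + r *\<^sub>R u) \<partial>lborel)"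
    using meas measurable_compose[OF _ meas, of "\<lambda>u. a + r *\<^sub>R u" lborel]
    by (simp add: nn_integral_density nn_integral_distr nn_integral_cmult)
  also have "(\<integral>\<^sup>+u. g (a + r *\<^sub>R u) * indicator (cball a r) (a + r *\<^sub>R u) \<partial>lborel) =
      (\<integral>\<^sup>+u. g (a + of_real r * u) * indicator (cball 0 1) u \<partial>lborel)"
    using r by (intro nn_integral_cong) (auto simp: indicator_def dist_norm norm_mult scaleR_conv_of_real)
  also have "\<dots> = (\<integral>\<^sup>+u. g (a + of_real r * u) \<partial>disc)"
    by (simp add: disc_def nn_integral_restrict_space)
  finally show ?thesis .
qed

text \<open>Restrict the integral defining the norm to the ball, where the weight is at least
  \<open>m\<close>, and rescale the ball to the unit disc.\<close>

lemma L2_norm_ge_disc: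
  assumes \<Omega>: "open \<Omega>" and W: "continuous_on \<Omega> W" and sub: "cball a r \<subseteq> \<Omega>"
    and m: "\<And>z. z \<in> cball a r \<Longrightarrow> m \<le> W z" "0 \<le> m"
    and f: "f \<in> L2 \<Omega> W" "continuous_on \<Omega> f" and r: "0 < r"
  shows "m * r\<^sup>2 * (\<integral>u. (norm (f (a + of_real r * u)))\<^sup>2 \<partial>disc) \<le> (L2_norm \<Omega> W f)\<^sup>2"
proof -
  have ball: "a + of_real r * u \<in> cball a r" if "u \<in> cball 0 1" for u
    using that r by (simp add: dist_norm norm_mult)
  have cont: "continuous_on (cball 0 1) (\<lambda>u. (norm (f (a + of_real r * u)))\<^sup>2)"
    using ball sub by (intro continuous_intros continuous_on_compose2[OF f(2)]) blast
  define g where "g z = ennreal ((norm (f z))\<^sup>2)" for z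
  have "(\<lambda>z. indicator (cball a r) z *\<^sub>R (norm (f z))\<^sup>2) \<in> borel_measurable borel"
    using continuous_on_subset[OF f(2) sub]
    by (intro borel_measurable_continuous_on_indicator continuous_intros) auto
  then have "(\<lambda>z. ennreal (indicator (cball a r) z *\<^sub>R (norm (f z))\<^sup>2)) \<in> borel_measurable borel"
    by simp
  also have "(\<lambda>z. ennreal (indicator (cball a r) z *\<^sub>R (norm (f z))\<^sup>2)) = (\<lambda>z. g z * indicator (cball a r) z)"
    by (auto simp: g_def indicator_def)
  finally have meas: "(\<lambda>z. g z * indicator (cball a r) z) \<in> borel_measurable borel" .
  have leb: "\<phi> \<in> borel_measurable (lebesgue_on \<Omega>)" if "continuous_on \<Omega> \<phi>" for \<phi> :: "complex \<Rightarrow> real"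
    using that \<Omega> by (intro continuous_imp_measurable_on_sets_lebesgue) auto
  \<comment> \<open>The chain runs through nonnegative integrals, so enlarging the domain is plain
    monotonicity; finiteness enters only at its two ends.\<close>
  have "ennreal (m * r\<^sup>2 * (\<integral>u. (norm (f (a + of_real r * u)))\<^sup>2 \<partial>disc)) =
      ennreal m * (ennreal (r\<^sup>2) * (\<integral>\<^sup>+u. g (a + of_real r * u) \<partial>disc))"
    unfolding g_def using m r
    by (subst nn_integral_eq_integral[OF integrable_disc_continuous[OF cont]])
      (auto simp: ennreal_mult[symmetric] integral_nonneg_AE mult_ac)
  also have "\<dots> = ennreal m * (\<integral>\<^sup>+z. g z * indicator (cball a r) z \<partial>lebesgue)"
    by (simp add: nn_integral_disc_affine[OF meas r] nn_integral_completion)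
  also have "\<dots> = (\<integral>\<^sup>+z. ennreal m * (g z * indicator (cball a r) z) \<partial>lebesgue)"
    using meas by (subst nn_integral_cmult) (auto intro: measurable_completion)
  also have "\<dots> \<le> (\<integral>\<^sup>+z. ennreal (W z) * g z * indicator \<Omega> z \<partial>lebesgue)"
    using m(1) sub by (intro nn_integral_mono) (auto simp: indicator_def ennreal_leI mult_right_mono)
  also have "\<dots> = (\<integral>\<^sup>+z. ennreal (W z) * g z \<partial>lebesgue_on \<Omega>)"
    using \<Omega> by (subst nn_integral_restrict_space) auto
  also have "\<dots> = (\<integral>\<^sup>+z. g z \<partial>weighted_measure \<Omega> W)"
    unfolding weighted_measure_def g_def using W f(2)
    by (subst nn_integral_density)
      (auto intro!: measurable_compose[OF leb measurable_ennreal] leb continuous_intros)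
  also have "\<dots> = ennreal ((L2_norm \<Omega> W f)\<^sup>2)"
    using f(1) unfolding L2_def L2_norm_def g_def
    by (subst nn_integral_eq_integral) (auto simp: integral_nonneg_AE)
  finally show ?thesis by simp
qed

(* The Cauchy-Schwarz bound, obtained by integrating x <= t/2 + x^2/(2t); allowing any t above the
   norm avoids a case distinction for norm zero. *)
lemma norm_disc_mean_le:
  assumes "open \<Omega>" "continuous_on \<Omega> W" and sub: "cball a r \<subseteq> \<Omega>"
    and m: "\<And>z. z \<in> cball a r \<Longrightarrow> m \<le> W z" "0 < m"
    and f: "f \<in> L2 \<Omega> W" "continuous_on \<Omega> f"
    and s: "0 < s" "s \<le> r" and t: "L2_norm \<Omega> W f < t"
  shows "norm (\<integral>u. f (a + of_real r * u) \<partial>disc) \<le>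
    t * (measure disc (cball 0 1) / 2 + 1 / (2 * m * s\<^sup>2))"
proof -
  interpret finite_measure disc by (rule finite_measure_disc)
  define N where "N = L2_norm \<Omega> W f"
  have N: "0 \<le> N" "N < t"
    using t by (auto simp: N_def L2_norm_def integral_nonneg_AE)
  have ball: "a + of_real r * u \<in> cball a r" if "u \<in> cball 0 1" for u
    using that s by (simp add: dist_norm norm_mult)
  have cont: "continuous_on (cball 0 1) (\<lambda>u. f (a + of_real r * u))"
    using ball sub by (intro continuous_intros continuous_on_compose2[OF f(2)]) blast
  define I where "I = (\<integral>u. (norm (f (a + of_real r * u)))\<^sup>2 \<partial>disc)"
  have int2: "integrable disc (\<lambda>u. (norm (f (a + of_real r * u)))\<^sup>2)"
    by (intro integrable_disc_continuous continuous_intros cont)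
  have "I \<ge> 0"
    by (simp add: I_def integral_nonneg_AE)
  have am_gm: "x \<le> t / 2 + x\<^sup>2 / (2 * t)" for x :: real
  proof -
    have "0 \<le> (x - t)\<^sup>2 / (2 * t)"
      using N by simp
    also have "\<dots> = t / 2 + x\<^sup>2 / (2 * t) - x"
      using N by (simp add: power2_eq_square field_simps)
    finally show ?thesis by simp
  qed
  have "norm (\<integral>u. f (a + of_real r * u) \<partial>disc) \<le> (\<integral>u. norm (f (a + of_real r * u)) \<partial>disc)"
    by (rule integral_norm_bound)
  also have "\<dots> \<le> (\<integral>u. t / 2 + (norm (f (a + of_real r * u)))\<^sup>2 / (2 * t) \<partial>disc)"
    using int2 am_gm
    by (intro integral_mono Bochner_Integration.integrable_add integrable_norm
        integrable_disc_continuous[OF cont]) auto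
  also have "\<dots> = t / 2 * measure disc (cball 0 1) + I / (2 * t)"
    using int2 by (subst Bochner_Integration.integral_add) (auto simp: I_def)
  \<comment> \<open>Replacing the radius \<open>r\<close> by its lower bound \<open>s\<close> gives
    one estimate valid for all radii in use.\<close>
  also have "I \<le> t\<^sup>2 / (m * s\<^sup>2)"
  proof -
    have "m * s\<^sup>2 * I \<le> m * r\<^sup>2 * I"
      using m s \<open>I \<ge> 0\<close> by (intro mult_right_mono mult_left_mono power_mono) auto
    also have "\<dots> \<le> N\<^sup>2"
      unfolding I_def N_def using assms by (intro L2_norm_ge_disc) auto
    also have "\<dots> \<le> t\<^sup>2"
      using N by (intro power_mono) auto
    finally show ?thesis
      using m s by (simp add: field_simps)
  qed
  then have "I / (2 * t) \<le> t\<^sup>2 / (m * s\<^sup>2) / (2 * t)"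
    using N by (intro divide_right_mono) auto
  also have "\<dots> = t * (1 / (2 * m * s\<^sup>2))"
    using N by (simp add: power2_eq_square)
  finally show ?thesis
    by (simp add: algebra_simps)
qed

section \<open>Bound for evaluation at one point\<close>

text \<open>The vanishing finite difference is solved for its term \<open>j = 0\<close>, which is
  the area of the disc times \<open>f a\<close>. The other means share one bound, and their binomial
  coefficients sum to at most \<open>2 ^ n\<close>.\<close>

lemma n_analytic_point_evaluation_bound:
  assumes \<Omega>: "open \<Omega>" and W: "continuous_on \<Omega> W" and R: "0 < R" and sub: "cball a R \<subseteq> \<Omega>"
    and m: "\<And>z. z \<in> cball a R \<Longrightarrow> m \<le> W z" "0 < m"
    and f: "f \<in> poly_bergman n \<Omega> W"
  defines "v \<equiv> measure disc (cball 0 1)" and "s \<equiv> R / (sqrt (real n) + 1)"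
  shows "norm (f a) \<le> 2 ^ n / v * (v / 2 + 1 / (2 * m * s\<^sup>2)) * L2_norm \<Omega> W f"
proof -
  have L2: "f \<in> L2 \<Omega> W" and an: "n_analytic_on n f \<Omega>"
    using f by (auto simp: poly_bergman_def)
  have "Ck_on 0 f \<Omega>"
    using an unfolding n_analytic_on_def smooth_on_def by blast
  then have cont: "continuous_on \<Omega> f" by simp
  have v: "v > 0"
    by (simp add: v_def measure_disc_pos)
  have n: "sqrt (real n) + 1 > 0"
    by (simp add: add_nonneg_pos)
  then have s: "0 < s"
    using R by (simp add: s_def)
  \<comment> \<open>The summand 1 in the denominator of \<open>s\<close> keeps the largest radius
    strictly below \<open>R\<close> and avoids division by zero for \<open>n = 0\<close>.\<close>
  have "sqrt (real n) * s < (sqrt (real n) + 1) * s"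
    using s by simp
  also have "\<dots> = R"
    using n by (simp add: s_def)
  finally have sn: "sqrt (real n) * s < R" .
  obtain h where hol: "\<And>k. h k holomorphic_on \<Omega>"
    and h: "\<And>z. z \<in> \<Omega> \<Longrightarrow> f z = (\<Sum>k<n. cnj (z - a) ^ k * h k z)"
    using n_analytic_decomposition[OF \<Omega> an, of a] by blast
  define M where "M j = (\<integral>u. f (a + of_real (sqrt (real j) * s) * u) \<partial>disc)" for j :: nat
  have "(\<Sum>j\<le>n. (-1) ^ j * of_nat (n choose j) * M j) = 0"
    unfolding M_def
  proof (rule disc_mean_alternating_sum)
    show "h k holomorphic_on ball a R" for k
      using order_trans[OF ball_subset_cball sub] by (rule holomorphic_on_subset[OF hol])
    show "f z = (\<Sum>k<n. cnj (z - a) ^ k * h k z)" if "z \<in> ball a R" for z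
      using that sub by (intro h) auto
  qed (use s sn in auto)
  moreover have "{..n} = insert 0 {1..n}"
    by auto
  \<comment> \<open>At radius 0 the integrand is the constant \<open>f a\<close>.\<close>
  moreover have "M 0 = of_real v * f a"
    by (simp add: M_def v_def scaleR_conv_of_real)
  ultimately have "of_real v * f a = - (\<Sum>j\<in>{1..n}. (-1) ^ j * of_nat (n choose j) * M j)"
    by (simp add: \<open>{..n} = insert 0 {1..n}\<close> eq_neg_iff_add_eq_0)
  then have "norm (of_real v * f a) = norm (- (\<Sum>j\<in>{1..n}. (-1) ^ j * of_nat (n choose j) * M j))"
    by (rule arg_cong)
  then have "v * norm (f a) = norm (\<Sum>j\<in>{1..n}. (-1) ^ j * of_nat (n choose j) * M j)"
    using v by (simp add: norm_mult)
  also have "\<dots> \<le> (\<Sum>j\<in>{1..n}. real (n choose j) * norm (M j))"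
    by (rule order_trans[OF norm_sum]) (simp add: norm_mult norm_power)
  finally have sum: "v * norm (f a) \<le> (\<Sum>j\<in>{1..n}. real (n choose j) * norm (M j))" .
  have bound: "norm (f a) \<le> 2 ^ n / v * (v / 2 + 1 / (2 * m * s\<^sup>2)) * t" if t: "L2_norm \<Omega> W f < t" for t
  proof -
    define B where "B = t * (v / 2 + 1 / (2 * m * s\<^sup>2))"
    have "0 \<le> L2_norm \<Omega> W f"
      by (simp add: L2_norm_def integral_nonneg_AE)
    then have B: "0 \<le> B"
      using t v m by (simp add: B_def)
    have M: "norm (M j) \<le> B" if j: "j \<in> {1..n}" for j
    proof -
      have "sqrt (real j) * s \<le> sqrt (real n) * s"
        using j s by (intro mult_right_mono) auto
      then have "cball a (sqrt (real j) * s) \<subseteq> cball a R"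
        using sn by (intro subset_cball) auto
      \<comment> \<open>Here \<open>j \<ge> 1\<close> matters: every remaining radius is at least
        \<open>s\<close>.\<close>
      moreover have "1 * s \<le> sqrt (real j) * s"
        using j s by (intro mult_right_mono) auto
      ultimately show ?thesis
        unfolding M_def B_def v_def using sub m s
        by (intro norm_disc_mean_le[OF \<Omega> W _ _ m(2) L2 cont s _ t]) auto
    qed
    have "(\<Sum>j\<in>{1..n}. real (n choose j) * norm (M j)) \<le> (\<Sum>j\<in>{1..n}. real (n choose j) * B)"
      using M by (intro sum_mono mult_left_mono) auto
    also have "\<dots> \<le> (\<Sum>j\<le>n. real (n choose j) * B)"
      using B by (intro sum_mono2) auto
    also have "\<dots> = 2 ^ n * B"
      using choose_row_sum[of n] unfolding sum_distrib_right[symmetric] of_nat_sum[symmetric] by simp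
    finally have "v * norm (f a) \<le> 2 ^ n * B"
      using sum by simp
    then show ?thesis
      using v by (simp add: B_def field_simps)
  qed
  define c where "c = 2 ^ n / v * (v / 2 + 1 / (2 * m * s\<^sup>2))"
  have "c > 0"
    unfolding c_def using v m(2) s by (intro mult_pos_pos add_pos_pos divide_pos_pos) auto
  \<comment> \<open>Lets \<open>t\<close> decrease to the norm; dividing by \<open>c\<close> leaves
    \<open>t\<close> alone on the right, as \<open>dense_ge\<close> requires.\<close>
  have "norm (f a) / c \<le> L2_norm \<Omega> W f"
  proof (rule dense_ge)
    fix t assume "L2_norm \<Omega> W f < t"
    from bound[OF this] show "norm (f a) / c \<le> t"
      using \<open>c > 0\<close> unfolding c_def[symmetric] by (simp add: pos_divide_le_eq mult.commute)
  qed
  then show ?thesis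
    using \<open>c > 0\<close> unfolding c_def[symmetric] by (simp add: pos_divide_le_eq mult.commute)
qed

section \<open>Uniformity over the compact set\<close>

theorem lemma4p3:
  fixes n :: nat and \<Omega> K :: "complex set" and W :: "complex \<Rightarrow> real"
  assumes "open \<Omega>"
    and "continuous_on \<Omega> W"
    and "\<And>z. z \<in> \<Omega> \<Longrightarrow> W z > 0"
    and "compact K"
    and "K \<subseteq> \<Omega>"
  shows "\<exists>C>0. \<forall>f \<in> poly_bergman n \<Omega> W. \<forall>z\<in>K. norm (f z) \<le> C * L2_norm \<Omega> W f"
proof (cases "K = {}")
  \<comment> \<open>Any positive constant serves; the other case needs a point of \<open>K\<close>
    for the minimum of the weight to exist.\<close>
  case True
  then show ?thesis by (auto intro: exI[of _ 1])
next
  case False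
  obtain R where R: "R > 0" and sub: "(\<Union>x\<in>K. cball x R) \<subseteq> \<Omega>"
    using compact_subset_open_imp_cball_epsilon_subset[OF assms(4,1,5)] by blast
  \<comment> \<open>The closed \<open>R\<close>-neighbourhood of \<open>K\<close>, compact as a sum
    of two compact sets. The minimum of \<open>W\<close> on it is a positive lower bound for the
    weight on all the balls \<open>cball z R\<close> with \<open>z\<close> in \<open>K\<close> at
    once.\<close>
  define L where "L = {x + y |x y. x \<in> K \<and> y \<in> cball 0 R}"
  have L: "cball x R \<subseteq> L" if "x \<in> K" for x
  proof
    fix z assume "z \<in> cball x R"
    then have "z = x + (z - x)" "z - x \<in> cball 0 R"
      by (auto simp: dist_norm norm_minus_commute)
    then show "z \<in> L"
      using that unfolding L_def by blast
  qed
  have "L \<subseteq> \<Omega>"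
    using sub by (fastforce simp: L_def dist_norm)
  have "compact L"
    unfolding L_def using assms(4) by (intro compact_sums) auto
  moreover have "L \<noteq> {}"
    using False L R by fastforce
  moreover have "continuous_on L W"
    using assms(2) \<open>L \<subseteq> \<Omega>\<close> by (rule continuous_on_subset)
  ultimately obtain p where p: "p \<in> L" "\<And>z. z \<in> L \<Longrightarrow> W p \<le> W z"
    using continuous_attains_inf by metis
  have pos: "W p > 0"
    using p \<open>L \<subseteq> \<Omega>\<close> assms(3) by blast
  define v where "v = measure disc (cball 0 1)"
  define s where "s = R / (sqrt (real n) + 1)"
  \<comment> \<open>The pointwise constant with \<open>m\<close> taken to be \<open>W p\<close>; it
    involves neither \<open>f\<close> nor the point of \<open>K\<close>.\<close>
  define C where "C = 2 ^ n / v * (v / 2 + 1 / (2 * W p * s\<^sup>2))"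
  have "v > 0"
    by (simp add: v_def measure_disc_pos)
  then have "C > 0"
    unfolding C_def using pos by (intro mult_pos_pos add_pos_nonneg) auto
  moreover have "norm (f z) \<le> C * L2_norm \<Omega> W f" if "f \<in> poly_bergman n \<Omega> W" "z \<in> K" for f z
    unfolding C_def v_def s_def
  proof (rule n_analytic_point_evaluation_bound[OF assms(1,2) R _ _ pos that(1)])
    show "cball z R \<subseteq> \<Omega>"
      using sub that(2) by blast
    show "W p \<le> W w" if "w \<in> cball z R" for w
      using L[OF \<open>z \<in> K\<close>] that by (intro p(2)) blast
  qed
  ultimately show ?thesis by blast
qed

end
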